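(* Let $A, B \in \mathbb{R}^{n\times n}$. The generalized absolute value equation $Ax + B|x| = b$ has a unique solution $x \in \mathbb{R}^n$ for every $b \in \mathbb{R}^{n}$ if and only if the matrix $A + B\bar{D}$ is nonsingular for every diagonal matrix $\bar{D} = \mathrm{diag}(\bar{d}_{i}) \in \mathbb{R}^{n\times n}$ with $\bar{d}_{i} \in [-1,1]$ for all $i$.
   Context: For $x \in \mathbb{R}^n$, $|x|$ denotes the componentwise absolute value of $x$. *)

theory Defs
  imports "HOL-Analysis.Analysis"
begin

definition diag_matrix :: "real ^ 'n \<Rightarrow> real ^ 'n ^ 'n" where
  "diag_matrix d = (\<chi> i j. if i = j then d $ i else 0)"

(* On real ^ 'n the library's \<bar>x\<bar> is the componentwise absolute value. *)
lemma "\<bar>x :: real ^ 'n\<bar> = (\<chi> i. \<bar>x $ i\<bar>)"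
  by (simp add: abs_vec_def)

end

theory Submission
  imports Defs
begin

text \<open>
  Write \<open>F x = A x + B |x|\<close>. For all \<open>x\<close>, \<open>y\<close> there is a diagonal matrix \<open>D\<close> with entries in
  \<open>[-1,1]\<close> such that \<open>|x| - |y| = D (x - y)\<close>, and conversely every \<open>D z\<close> with such a \<open>D\<close> has the
  form \<open>|x| - |y|\<close> with \<open>x - y = z\<close>. So \<open>F x - F y = (A + B D) (x - y)\<close>, and \<open>F\<close> is injective iff
  all the matrices \<open>A + B D\<close> are nonsingular. In that case compactness of the set of pairs of such a
  \<open>D\<close> and a unit vector makes \<open>F\<close> expansive up to a constant. Hence the range of \<open>F\<close> is closed,
  while it is open by invariance of domain, and \<open>F\<close> is surjective.
\<close>

lemma diag_matrix_mult_vec: "diag_matrix d *v v = d * v"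
  by (simp add: vec_eq_iff diag_matrix_def matrix_vector_mult_def if_distrib[of "\<lambda>t. t * _"]
      cong: if_cong)

lemma add_mult_diag_matrix_vec:
  fixes A B :: "real ^ 'n ^ 'n"
  shows "(A + B ** diag_matrix d) *v v = A *v v + B *v (d * v)"
  by (simp add: matrix_vector_mult_add_rdistrib diag_matrix_mult_vec
      flip: matrix_vector_mul_assoc)

lemma invertible_iff_trivial_kernel:
  fixes M :: "real ^ 'n ^ 'n"
  shows "invertible M \<longleftrightarrow> (\<forall>v. M *v v = 0 \<longrightarrow> v = 0)"
  by (simp add: invertible_left_inverse matrix_left_invertible_ker)

lemma abs_diff_eq_mult_vec:
  fixes x y :: "real ^ 'n"
  obtains d where "\<forall>i. d $ i \<in> {-1..1}" "\<bar>x\<bar> - \<bar>y\<bar> = d * (x - y)"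
proof
  \<comment> \<open>Difference quotients of the absolute value. Where \<open>x $ i = y $ i\<close>,
    division by zero makes the entry 0, which lies in the interval, and both sides of the identity
    vanish.\<close>
  let ?d = "\<chi> i. (\<bar>x $ i\<bar> - \<bar>y $ i\<bar>) / (x $ i - y $ i)"
  show "\<forall>i. ?d $ i \<in> {-1..1}"
  proof
    fix i
    have "\<bar>(\<bar>x $ i\<bar> - \<bar>y $ i\<bar>) / (x $ i - y $ i)\<bar> \<le> 1"
      using abs_triangle_ineq3[of "x $ i" "y $ i"] by (simp add: divide_le_eq)
    then show "?d $ i \<in> {-1..1}"
      unfolding abs_le_iff by simp
  qed
  show "\<bar>x\<bar> - \<bar>y\<bar> = ?d * (x - y)"
    by (simp add: vec_eq_iff abs_vec_def)
qed

lemma mult_vec_eq_abs_diff: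
  fixes d z :: "real ^ 'n"
  assumes "\<forall>i. d $ i \<in> {-1..1}"
  obtains x y where "x - y = z" "\<bar>x\<bar> - \<bar>y\<bar> = d * z"
proof
  \<comment> \<open>Chosen so that \<open>x - y = z\<close> and
    \<open>x + y = d * \<bar>z\<bar>\<close>. As \<open>\<bar>d $ i\<bar> \<le> 1\<close>, the sign
    of \<open>x $ i\<close> agrees weakly with that of \<open>z $ i\<close> and that of
    \<open>y $ i\<close> is opposite, so \<open>\<bar>x $ i\<bar> - \<bar>y $ i\<bar>\<close> is
    \<open>x $ i + y $ i\<close> up to the sign of \<open>z $ i\<close>, that is
    \<open>d $ i * z $ i\<close>.\<close>
  let ?x = "\<chi> i. (d $ i * \<bar>z $ i\<bar> + z $ i) / 2"
  let ?y = "\<chi> i. (d $ i * \<bar>z $ i\<bar> - z $ i) / 2"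
  show "?x - ?y = z"
    by (simp add: vec_eq_iff field_simps)
  have "\<bar>(d $ i * \<bar>z $ i\<bar> + z $ i) / 2\<bar> - \<bar>(d $ i * \<bar>z $ i\<bar> - z $ i) / 2\<bar> = d $ i * z $ i" for i
  proof -
    have "\<bar>d $ i\<bar> \<le> 1"
      using spec[OF assms, of i] by (simp add: abs_le_iff)
    then have "\<bar>d $ i * z $ i\<bar> \<le> \<bar>z $ i\<bar>"
      by (simp add: abs_mult mult_left_le_one_le)
    then show ?thesis
      using spec[OF assms, of i] by (cases "z $ i \<ge> 0") (auto simp: abs_if field_simps split: if_splits)
  qed
  then show "\<bar>?x\<bar> - \<bar>?y\<bar> = d * z"
    by (simp add: vec_eq_iff abs_vec_def)
qed

lemma continuous_on_times_vec [continuous_intros]: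
  fixes f g :: "'a::topological_space \<Rightarrow> real ^ 'n"
  assumes "continuous_on S f" "continuous_on S g"
  shows "continuous_on S (\<lambda>x. f x * g x)"
  unfolding times_vec_def by (intro continuous_intros assms)

text \<open>The kernel vectors of the matrices \<open>A + B ** diag_matrix d\<close> are exactly the
  differences of points with equal image.\<close>

lemma inj_abs_map_iff:
  fixes A B :: "real ^ 'n ^ 'n"
  shows "inj (\<lambda>x. A *v x + B *v \<bar>x\<bar>) \<longleftrightarrow>
         (\<forall>d. (\<forall>i. d $ i \<in> {-1..1}) \<longrightarrow> invertible (A + B ** diag_matrix d))"
    (is "inj ?F \<longleftrightarrow> ?R")
proof
  assume inj: "inj ?F"
  show ?R
  proof (intro allI impI)
    fix d :: "real ^ 'n"
    assume d: "\<forall>i. d $ i \<in> {-1..1}"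
    have "z = 0" if z: "A *v z + B *v (d * z) = 0" for z
    proof -
      obtain x y where xy: "x - y = z" "\<bar>x\<bar> - \<bar>y\<bar> = d * z"
        by (rule mult_vec_eq_abs_diff[OF d])
      have "?F x - ?F y = A *v (x - y) + B *v (\<bar>x\<bar> - \<bar>y\<bar>)"
        by (simp add: matrix_vector_mult_diff_distrib)
      then have "?F x = ?F y"
        using xy z by simp
      then have "x = y"
        by (rule injD[OF inj])
      then show "z = 0"
        using xy(1) by simp
    qed
    then show "invertible (A + B ** diag_matrix d)"
      unfolding invertible_iff_trivial_kernel add_mult_diag_matrix_vec by blast
  qed
next
  assume R: ?R
  show "inj ?F"
  proof (rule injI)
    fix x y
    assume eq: "?F x = ?F y"
    obtain d where d: "\<forall>i. d $ i \<in> {-1..1}" "\<bar>x\<bar> - \<bar>y\<bar> = d * (x - y)"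
      by (rule abs_diff_eq_mult_vec)
    have "A *v (x - y) + B *v (\<bar>x\<bar> - \<bar>y\<bar>) = ?F x - ?F y"
      by (simp add: matrix_vector_mult_diff_distrib)
    then have "(A + B ** diag_matrix d) *v (x - y) = 0"
      unfolding add_mult_diag_matrix_vec d(2) eq by simp
    moreover have "invertible (A + B ** diag_matrix d)"
      using R d(1) by blast
    ultimately have "x - y = 0"
      unfolding invertible_iff_trivial_kernel by blast
    then show "x = y"
      by simp
  qed
qed

text \<open>The point is that \<open>c\<close> does not depend on \<open>d\<close>: it is the
  minimum of a continuous positive function over all admissible \<open>d\<close> and all unit
  vectors \<open>v\<close>. Homogeneity in \<open>v\<close> does the rest.\<close>

lemma diag_family_lower_bound:
  fixes A B :: "real ^ 'n ^ 'n"
  assumes "\<And>d. (\<forall>i. d $ i \<in> {-1..1}) \<Longrightarrow> invertible (A + B ** diag_matrix d)"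
  obtains c where "c > 0"
    "\<And>d v. (\<forall>i. d $ i \<in> {-1..1}) \<Longrightarrow> c * norm v \<le> norm (A *v v + B *v (d * v))"
proof -
  let ?K = "cbox (\<chi> i. -1) (\<chi> i. 1) \<times> sphere 0 1 :: ((real ^ 'n) \<times> (real ^ 'n)) set"
  let ?g = "\<lambda>p. norm (A *v snd p + B *v (fst p * snd p))"
  have K: "p \<in> ?K \<longleftrightarrow> (\<forall>i. fst p $ i \<in> {-1..1}) \<and> norm (snd p) = 1" for p
    by (cases p) (auto simp: mem_box_cart)
  \<comment> \<open>The minimum is attained only on a nonempty set; \<open>undefined\<close> serves
    as an arbitrary index.\<close>
  have "axis undefined 1 \<in> sphere (0 :: real ^ 'n) 1"
    by simp
  moreover have "(0 :: real ^ 'n) \<in> cbox (\<chi> i. -1) (\<chi> i. 1)"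
    by (simp add: mem_box_cart)
  ultimately have "?K \<noteq> {}"
    by blast
  moreover have "compact ?K"
    by (intro compact_Times compact_cbox compact_sphere)
  moreover have "continuous_on ?K ?g"
    by (intro continuous_intros
        linear_continuous_on_compose[OF _ matrix_vector_mul_linear])
  ultimately obtain p where p: "p \<in> ?K" "\<And>q. q \<in> ?K \<Longrightarrow> ?g p \<le> ?g q"
    using continuous_attains_inf[of ?K ?g] by blast
  have "snd p \<noteq> 0"
    using p(1) K by force
  then have "?g p > 0"
    using assms[of "fst p"] p(1) K[of p]
    by (auto simp: invertible_iff_trivial_kernel simp flip: add_mult_diag_matrix_vec)
  moreover have "?g p * norm v \<le> norm (A *v v + B *v (d * v))" if d: "\<forall>i. d $ i \<in> {-1..1}" for d v
  proof (cases "v = 0")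
    case False
    let ?w = "v /\<^sub>R norm v"
    have "?g p \<le> ?g (d, ?w)"
      using d False by (intro p(2)) (simp add: K)
    moreover have "A *v ?w + B *v (d * ?w) = (A *v v + B *v (d * v)) /\<^sub>R norm v"
      by (metis add_mult_diag_matrix_vec matrix_vector_mult_scaleR)
    ultimately have "?g p \<le> norm (A *v v + B *v (d * v)) / norm v"
      by (simp add: divide_inverse_commute)
    then show ?thesis
      using False by (simp add: pos_le_divide_eq)
  qed simp
  ultimately show ?thesis
    using that by blast
qed

text \<open>Expansiveness makes the preimages of a convergent sequence Cauchy; continuity sends
  their limit to the limit of the images.\<close>

lemma closed_range_expansive:
  fixes F :: "'a::complete_space \<Rightarrow> 'b::metric_space"
  assumes cont: "continuous_on UNIV F" and "c > 0"
    and F: "\<And>x y. c * dist x y \<le> dist (F x) (F y)"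
  shows "closed (range F)"
  unfolding closed_sequential_limits
proof (intro allI impI, elim conjE)
  fix s l
  assume s: "\<forall>n. s n \<in> range F" and lim: "s \<longlonglongrightarrow> l"
  have "\<forall>n. \<exists>x. s n = F x"
    using s by blast
  then obtain u where u: "s n = F (u n)" for n
    using choice[of "\<lambda>n x. s n = F x"] by blast
  have "Cauchy u"
    unfolding Cauchy_def
  proof (intro allI impI)
    fix e :: real
    assume "e > 0"
    then have "c * e > 0"
      using \<open>c > 0\<close> by simp
    then obtain N where N: "\<forall>m\<ge>N. \<forall>n\<ge>N. dist (s m) (s n) < c * e"
      using LIMSEQ_imp_Cauchy[OF lim] unfolding Cauchy_def by blast
    have "dist (u m) (u n) < e" if "m \<ge> N" "n \<ge> N" for m n
    proof -
      have "c * dist (u m) (u n) \<le> dist (s m) (s n)"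
        unfolding u by (rule F)
      also have "\<dots> < c * e"
        using N that by blast
      finally show ?thesis
        using \<open>c > 0\<close> by simp
    qed
    then show "\<exists>M. \<forall>m\<ge>M. \<forall>n\<ge>M. dist (u m) (u n) < e"
      by blast
  qed
  then obtain x where x: "u \<longlonglongrightarrow> x"
    using Cauchy_convergent convergent_def by blast
  have "isCont F x"
    using cont by (simp add: continuous_on_eq_continuous_at)
  then have "(\<lambda>n. F (u n)) \<longlonglongrightarrow> F x"
    using x by (rule isCont_tendsto_compose)
  moreover have "s = (\<lambda>n. F (u n))"
    using u by (rule ext)
  ultimately show "l \<in> range F"
    using lim LIMSEQ_unique by blast
qed

lemma surj_abs_map:
  fixes A B :: "real ^ 'n ^ 'n"
  assumes inv: "\<And>d. (\<forall>i. d $ i \<in> {-1..1}) \<Longrightarrow> invertible (A + B ** diag_matrix d)"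
  shows "surj (\<lambda>x. A *v x + B *v \<bar>x\<bar>)" (is "surj ?F")
proof -
  obtain c where c: "c > 0"
    "\<And>d v. (\<forall>i. d $ i \<in> {-1..1}) \<Longrightarrow> c * norm v \<le> norm (A *v v + B *v (d * v))"
    using diag_family_lower_bound inv by blast
  have cont: "continuous_on UNIV ?F"
    unfolding abs_vec_def
    by (intro continuous_intros linear_continuous_on_compose[OF _ matrix_vector_mul_linear])
  have "c * dist x y \<le> dist (?F x) (?F y)" for x y
  proof -
    \<comment> \<open>This \<open>d\<close> varies with \<open>x\<close> and \<open>y\<close>, so
      the uniformity of \<open>c\<close> is essential.\<close>
    obtain d where d: "\<forall>i. d $ i \<in> {-1..1}" "\<bar>x\<bar> - \<bar>y\<bar> = d * (x - y)"
      by (rule abs_diff_eq_mult_vec)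
    have "?F x - ?F y = A *v (x - y) + B *v (d * (x - y))"
      by (simp add: matrix_vector_mult_diff_distrib flip: d(2))
    then show ?thesis
      using c(2)[of d "x - y"] d(1) by (simp add: dist_norm)
  qed
  then have "closed (range ?F)"
    using closed_range_expansive cont c(1) by blast
  moreover have "open (range ?F)"
    using invariance_of_domain[OF cont open_UNIV] inj_abs_map_iff[of A B] inv by blast
  \<comment> \<open>The whole space is connected, so a nonempty set that is both closed and open is
    everything.\<close>
  ultimately show ?thesis
    using clopen[of "range ?F"] by blast
qed

theorem theorem3p2:
  fixes A B :: "real ^ 'n ^ 'n"
  shows "(\<forall>b :: real ^ 'n. \<exists>!x :: real ^ 'n. A *v x + B *v \<bar>x\<bar> = b) \<longleftrightarrow>
         (\<forall>d :: real ^ 'n. (\<forall>i. d $ i \<in> {-1..1}) \<longrightarrow> invertible (A + B ** diag_matrix d))"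
proof -
  let ?F = "\<lambda>x. A *v x + B *v \<bar>x\<bar>"
  have "(\<forall>b. \<exists>!x. ?F x = b) \<longleftrightarrow> bij ?F"
    by (simp add: bij_iff)
  \<comment> \<open>Injectivity gives nonsingularity of the whole family, and this in turn gives
    surjectivity.\<close>
  also have "\<dots> \<longleftrightarrow> inj ?F"
    unfolding bij_def using surj_abs_map[of A B] inj_abs_map_iff[of A B] by blast
  also note inj_abs_map_iff
  finally show ?thesis .
qed

end
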